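(* Let $d\in\mathbb{N}$, let $\sigma:\mathbb{N}\to\mathbb{R}$ be a nonincreasing zero sequence and let $\tau:\mathbb{N}\to\mathbb{R}$ be the nonincreasing rearrangement of its $d$th tensor power. For all $c>0$ and $s>0$, the following holds. (i) If $\sigma(n)\lesssim c\,n^{-s}$, then $\tau(n)\lesssim \frac{c^d}{((d-1)!)^s}\,n^{-s}(\log n)^{s(d-1)}$. (ii) If $\sigma(n)\gtrsim c\,n^{-s}$, then $\tau(n)\gtrsim \frac{c^d}{((d-1)!)^s}\,n^{-s}(\log n)^{s(d-1)}$.
   Context: $\mathbb{N}=\{1,2,\dots\}$ and $\log$ is the natural logarithm. A nonincreasing zero sequence is a nonincreasing sequence of real numbers converging to $0$ (hence nonnegative). The $d$th tensor power of $\sigma$ is $\sigma_d:\mathbb{N}^d\to\mathbb{R}$, $\sigma_d(n_1,\dots,n_d)=\prod_{j=1}^d\sigma(n_j)$. Its nonincreasing rearrangement $\tau:\mathbb{N}\to\mathbb{R}$ is the nonincreasing zero sequence for which $\tau(n)$ is the $n$th largest value of $\sigma_d$, counted with multiplicity. For sequences $f,g$ (with $g(n)>0$ for large $n$), $f(n)\lesssim g(n)$ means $\limsup_{n\to\infty} f(n)/g(n)\le 1$, and $f(n)\gtrsim g(n)$ means $\liminf_{n\to\infty} f(n)/g(n)\ge 1$. *)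

theory Defs
  imports "HOL-Analysis.Analysis"
begin

(* Sequences indexed by {1,2,...} are functions on nat whose value at 0 is irrelevant. *)

definition nonincreasing_zero_seq :: "(nat \<Rightarrow> real) \<Rightarrow> bool" where
  "nonincreasing_zero_seq \<sigma> \<longleftrightarrow> antimono_on {1..} \<sigma> \<and> \<sigma> \<longlonglongrightarrow> 0"

definition tuples :: "nat \<Rightarrow> (nat \<Rightarrow> nat) set" where
  "tuples d = {1..d} \<rightarrow>\<^sub>E {1..}"

definition tensor_power :: "nat \<Rightarrow> (nat \<Rightarrow> real) \<Rightarrow> (nat \<Rightarrow> nat) \<Rightarrow> real" where
  "tensor_power d \<sigma> n = (\<Prod>j=1..d. \<sigma> (n j))"

(* The superlevel set in the last conjunct may be infinite (this happens for v = 0 if f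
   has only finitely many positive values), and then its card is 0, whence the
   case distinction. *)
definition nth_largest :: "'a set \<Rightarrow> ('a \<Rightarrow> real) \<Rightarrow> nat \<Rightarrow> real \<Rightarrow> bool" where
  "nth_largest A f n v \<longleftrightarrow>
     v \<in> f ` A \<and>
     finite {a \<in> A. f a > v} \<and> card {a \<in> A. f a > v} < n \<and>
     (infinite {a \<in> A. f a \<ge> v} \<or> n \<le> card {a \<in> A. f a \<ge> v})"

definition nonincreasing_rearrangement ::
    "'a set \<Rightarrow> ('a \<Rightarrow> real) \<Rightarrow> (nat \<Rightarrow> real) \<Rightarrow> bool" where
  "nonincreasing_rearrangement A f \<tau> \<longleftrightarrow>
     nonincreasing_zero_seq \<tau> \<and> (\<forall>n\<ge>1. nth_largest A f n (\<tau> n))"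

(* Both relations are meant for g that are eventually positive. *)

definition asymp_le :: "(nat \<Rightarrow> real) \<Rightarrow> (nat \<Rightarrow> real) \<Rightarrow> bool"  (infix "\<lesssim>" 50) where
  "f \<lesssim> g \<longleftrightarrow> limsup (\<lambda>n. ereal (f n / g n)) \<le> 1"

definition asymp_ge :: "(nat \<Rightarrow> real) \<Rightarrow> (nat \<Rightarrow> real) \<Rightarrow> bool"  (infix "\<greatersim>" 50) where
  "f \<greatersim> g \<longleftrightarrow> liminf (\<lambda>n. ereal (f n / g n)) \<ge> 1"

lemma nth_largest_unique:
  assumes "nth_largest A f n v" "nth_largest A f n w"
  shows "v = w"
proof -
  have *: "\<not> x < y" if x: "nth_largest A f n x" and y: "nth_largest A f n y" for x y
  proof
    assume "x < y"
    then have sub: "{a \<in> A. f a \<ge> y} \<subseteq> {a \<in> A. f a > x}" by auto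
    moreover have fin: "finite {a \<in> A. f a > x}" using x by (simp add: nth_largest_def)
    ultimately have "finite {a \<in> A. f a \<ge> y}" by (rule finite_subset)
    then have "n \<le> card {a \<in> A. f a \<ge> y}" using y by (simp add: nth_largest_def)
    also have "\<dots> \<le> card {a \<in> A. f a > x}" by (rule card_mono[OF fin sub])
    also have "\<dots> < n" using x by (simp add: nth_largest_def)
    finally show False by simp
  qed
  from *[OF assms] *[OF assms(2,1)] show ?thesis by simp
qed

lemma nonincreasing_rearrangementI_bij:
  assumes \<tau>: "nonincreasing_zero_seq \<tau>" and \<phi>: "bij_betw \<phi> {1..} A"
    and eq: "\<And>n. n \<ge> 1 \<Longrightarrow> \<tau> n = f (\<phi> n)"
  shows "nonincreasing_rearrangement A f \<tau>"
  unfolding nonincreasing_rearrangement_def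
proof (intro conjI allI impI)
  fix n :: nat assume n: "n \<ge> 1"
  have mono: "\<tau> j \<le> \<tau> i" if "1 \<le> i" "i \<le> j" for i j
    using \<tau> that by (auto simp: nonincreasing_zero_seq_def monotone_on_def)
  have A: "A = \<phi> ` {1..}" and inj: "inj_on \<phi> {1..}"
    using \<phi> by (auto simp: bij_betw_def)
  have gt: "{a \<in> A. f a > \<tau> n} \<subseteq> \<phi> ` {1..<n}"
  proof
    fix a assume "a \<in> {a \<in> A. f a > \<tau> n}"
    then obtain k where k: "k \<ge> 1" "a = \<phi> k" "\<tau> k > \<tau> n" using A eq by auto
    with mono[OF n, of k] have "k < n" by (meson not_less)
    with k show "a \<in> \<phi> ` {1..<n}" by auto
  qed
  have ge: "\<phi> ` {1..n} \<subseteq> {a \<in> A. f a \<ge> \<tau> n}"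
  proof
    fix a assume "a \<in> \<phi> ` {1..n}"
    then obtain k where k: "1 \<le> k" "k \<le> n" "a = \<phi> k" by auto
    with mono[OF k(1,2)] eq[OF k(1)] A show "a \<in> {a \<in> A. f a \<ge> \<tau> n}" by auto
  qed
  have "card {a \<in> A. f a > \<tau> n} \<le> card (\<phi> ` {1..<n})"
    using gt by (intro card_mono) auto
  also have "\<dots> \<le> card {1..<n}" by (rule card_image_le) simp
  finally have c1: "card {a \<in> A. f a > \<tau> n} < n" using n by simp
  have "card (\<phi> ` {1..n}) = n"
    using inj by (subst card_image) (auto intro: inj_on_subset)
  then have c2: "n \<le> card {a \<in> A. f a \<ge> \<tau> n}" if "finite {a \<in> A. f a \<ge> \<tau> n}"
    using card_mono[OF that ge] by simp
  have "\<tau> n \<in> f ` A" using n A eq by auto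
  moreover have "finite {a \<in> A. f a > \<tau> n}" using gt by (rule finite_subset) simp
  ultimately show "nth_largest A f n (\<tau> n)"
    unfolding nth_largest_def using c1 c2 by blast
qed (rule \<tau>)

end

theory Submission
  imports Defs "HOL-Real_Asymp.Real_Asymp"
begin

text \<open>
  Put \<open>b n = \<sigma> n powr (1 / s)\<close> and let \<open>A\<^sub>d(x)\<close> be the number of \<open>d\<close>-tuples \<open>a\<close> with
  \<open>x * (\<Prod>j. b (a j)) > 1\<close>. Splitting off the last coordinate gives \<open>A\<^bsub>d+1\<^esub>(x) = (\<Sum>n. A\<^sub>d(x * b n))\<close>.
  Since \<open>b n\<close> compares to \<open>C / n\<close> with \<open>C = c powr (1 / s)\<close> and
  \<open>\<Sum>n\<le>z. ln (z / n) ^ k / n\<close> is asymptotic to \<open>ln z ^ (k + 1) / (k + 1)\<close>, induction shows that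
  \<open>A\<^sub>d(x)\<close> compares to \<open>C ^ d * x * ln x ^ (d - 1) / fact (d - 1)\<close>. Inverting this relation
  between \<open>x\<close> and \<open>n = A\<^sub>d(x)\<close> gives the asymptotics of \<open>\<tau> n = x powr -s\<close>.
\<close>

subsection \<open>Logarithmic sums\<close>

text \<open>The difference is \<open>Suc k\<close> times the integral of \<open>t ^ k\<close> over
  \<open>[b, a]\<close>, where the integrand lies between \<open>b ^ k\<close> and
  \<open>a ^ k\<close>. The induction avoids integrals by peeling off one factor \<open>a\<close> or
  \<open>b\<close>.\<close>

lemma power_Suc_diff_bounds:
  fixes a b :: real
  assumes "0 \<le> b" "b \<le> a"
  shows "real (Suc k) * b ^ k * (a - b) \<le> a ^ Suc k - b ^ Suc k"
    and "a ^ Suc k - b ^ Suc k \<le> real (Suc k) * a ^ k * (a - b)"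
proof -
  have "real (Suc k) * b ^ k * (a - b) \<le> a ^ Suc k - b ^ Suc k \<and>
        a ^ Suc k - b ^ Suc k \<le> real (Suc k) * a ^ k * (a - b)"
  proof (induction k)
    case (Suc k)
    have le: "b ^ Suc k \<le> a ^ Suc k" using assms by (intro power_mono) auto
    have "real (Suc (Suc k)) * b ^ Suc k * (a - b)
        = b * (real (Suc k) * b ^ k * (a - b)) + b ^ Suc k * (a - b)"
      by (simp add: algebra_simps)
    also have "\<dots> \<le> b * (a ^ Suc k - b ^ Suc k) + a ^ Suc k * (a - b)"
      using Suc assms le by (intro add_mono mult_left_mono mult_right_mono) auto
    finally have 1: "real (Suc (Suc k)) * b ^ Suc k * (a - b) \<le> a ^ Suc (Suc k) - b ^ Suc (Suc k)"
      by (simp add: algebra_simps)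
    have "a ^ Suc (Suc k) - b ^ Suc (Suc k) = a * (a ^ Suc k - b ^ Suc k) + b ^ Suc k * (a - b)"
      by (simp add: algebra_simps)
    also have "\<dots> \<le> a * (real (Suc k) * a ^ k * (a - b)) + a ^ Suc k * (a - b)"
      using Suc assms le by (intro add_mono mult_left_mono mult_right_mono) auto
    finally show ?case using 1 by (simp add: algebra_simps)
  qed simp
  then show "real (Suc k) * b ^ k * (a - b) \<le> a ^ Suc k - b ^ Suc k"
    and "a ^ Suc k - b ^ Suc k \<le> real (Suc k) * a ^ k * (a - b)" by auto
qed

text \<open>Both bounds are instances of \<open>ln t <= t - 1\<close>, at
  \<open>t = n / (n + 1)\<close> and at \<open>t = (n + 1) / n\<close>. They replace the comparison
  of a sum with an integral.\<close>

lemma ln_Suc_diff_bounds: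
  assumes "n \<ge> 1"
  shows "1 / real (Suc n) \<le> ln (real (Suc n)) - ln (real n)"
    and "ln (real (Suc n)) - ln (real n) \<le> 1 / real n"
proof -
  have "ln (real n / real (Suc n)) \<le> real n / real (Suc n) - 1"
    using assms by (intro ln_le_minus_one) auto
  then show "1 / real (Suc n) \<le> ln (real (Suc n)) - ln (real n)"
    using assms by (simp add: ln_div field_simps)
  have "ln (real (Suc n) / real n) \<le> real (Suc n) / real n - 1"
    using assms by (intro ln_le_minus_one) auto
  then show "ln (real (Suc n)) - ln (real n) \<le> 1 / real n"
    using assms by (simp add: ln_div field_simps)
qed

text \<open>For \<open>n >= 2\<close> the summand is at most the drop of
  \<open>ln (Z / t) ^ Suc k / Suc k\<close> as \<open>t\<close> goes from \<open>n - 1\<close> to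
  \<open>n\<close>, and these drops telescope. The summand at 1 gives the extra
  \<open>ln Z ^ k\<close>. The condition \<open>N <= Z\<close> keeps all logarithms
  nonnegative.\<close>

lemma sum_ln_power_upper:
  assumes "1 \<le> N" "real N \<le> Z"
  shows "(\<Sum>n=1..N. ln (Z / real n) ^ k / real n)
       \<le> ln Z ^ k + (ln Z ^ Suc k - ln (Z / real N) ^ Suc k) / real (Suc k)"
  using assms
proof (induction N rule: nat_induct_at_least)
  case (Suc n)
  have Z: "Z > 0" "real (Suc n) \<le> Z" "real n \<le> Z" using Suc by auto
  define a b where "a = ln (Z / real n)" and "b = ln (Z / real (Suc n))"
  have b: "0 \<le> b" unfolding b_def using Z by (intro ln_ge_zero) (auto simp: field_simps)
  have ab: "a - b = ln (real (Suc n)) - ln (real n)"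
    unfolding a_def b_def using Z Suc.hyps by (simp add: ln_div)
  have step: "1 / real (Suc n) \<le> a - b" using ln_Suc_diff_bounds(1)[OF Suc.hyps] ab by simp
  then have "b \<le> a" by (smt (verit) divide_nonneg_nonneg of_nat_0_le_iff)
  have "real (Suc k) * (b ^ k / real (Suc n)) = real (Suc k) * b ^ k * (1 / real (Suc n))" by simp
  also have "\<dots> \<le> real (Suc k) * b ^ k * (a - b)"
    using step b by (intro mult_left_mono) auto
  also have "\<dots> \<le> a ^ Suc k - b ^ Suc k" by (rule power_Suc_diff_bounds) fact+
  finally have "b ^ k / real (Suc n) \<le> (a ^ Suc k - b ^ Suc k) / real (Suc k)"
    by (simp add: pos_le_divide_eq mult.commute)
  moreover have "(\<Sum>n=1..n. ln (Z / real n) ^ k / real n)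
       \<le> ln Z ^ k + (ln Z ^ Suc k - a ^ Suc k) / real (Suc k)"
    unfolding a_def using Z Suc.IH by auto
  moreover have "(\<Sum>n=1..Suc n. ln (Z / real n) ^ k / real n)
     = (\<Sum>n=1..n. ln (Z / real n) ^ k / real n) + b ^ k / real (Suc n)"
    unfolding b_def by simp
  ultimately show ?case unfolding b_def[symmetric] by (simp add: diff_divide_distrib)
qed simp

text \<open>Here the summand at \<open>n\<close> is at least the drop from \<open>n\<close> to
  \<open>n + 1\<close>, hence the half-open range. The start \<open>m\<close> is free because the
  bound on \<open>b\<close> will hold only from some index on.\<close>

lemma sum_ln_power_lower:
  assumes "1 \<le> m" "m \<le> N" "real N \<le> Z"
  shows "(ln (Z / real m) ^ Suc k - ln (Z / real N) ^ Suc k) / real (Suc k)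
       \<le> (\<Sum>n=m..<N. ln (Z / real n) ^ k / real n)"
  using assms(2,3)
proof (induction N rule: dec_induct)
  case (step n)
  have Z: "Z > 0" "real (Suc n) \<le> Z" "real n \<le> Z" and n: "n \<ge> 1" using step assms(1) by auto
  define a b where "a = ln (Z / real n)" and "b = ln (Z / real (Suc n))"
  have b: "0 \<le> b" unfolding b_def using Z by (intro ln_ge_zero) (auto simp: field_simps)
  have ab: "a - b = ln (real (Suc n)) - ln (real n)"
    unfolding a_def b_def using Z n by (simp add: ln_div)
  have le: "a - b \<le> 1 / real n" using ln_Suc_diff_bounds(2)[OF n] ab by simp
  have "ln (real n) \<le> ln (real (Suc n))" using n by simp
  then have "b \<le> a" using ab by linarith
  have "a ^ Suc k - b ^ Suc k \<le> real (Suc k) * a ^ k * (a - b)"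
    by (rule power_Suc_diff_bounds) fact+
  also have "\<dots> \<le> real (Suc k) * a ^ k * (1 / real n)"
    using le b \<open>b \<le> a\<close> by (intro mult_left_mono) auto
  finally have "(a ^ Suc k - b ^ Suc k) / real (Suc k) \<le> a ^ k / real n"
    by (simp add: pos_divide_le_eq mult.commute)
  moreover have "(ln (Z / real m) ^ Suc k - a ^ Suc k) / real (Suc k)
       \<le> (\<Sum>n=m..<n. ln (Z / real n) ^ k / real n)"
    unfolding a_def using Z step.IH by auto
  moreover have "(\<Sum>n=m..<Suc n. ln (Z / real n) ^ k / real n)
     = (\<Sum>n=m..<n. ln (Z / real n) ^ k / real n) + a ^ k / real n"
    unfolding a_def using step by simp
  ultimately show ?case unfolding b_def[symmetric] by (simp add: diff_divide_distrib)
qed simp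

subsection \<open>Convolution with a sequence comparable to the harmonic one\<close>

text \<open>The sum is split into three ranges: finitely many \<open>n < m\<close>, each of size
  O(\<open>x * ln x ^ k\<close>); later \<open>n\<close> with \<open>x * b n < Y\<close>, which are
  O(\<open>x\<close>) in number and contribute at most \<open>f Y\<close> each; and the rest, where
  both asymptotic bounds apply. Only the last range reaches the order
  \<open>x * ln x ^ Suc k\<close>, by \<open>sum_ln_power_upper\<close>. The cutoff
  \<open>x0\<close> loses no summand, as \<open>f\<close> vanishes below it.\<close>

lemma convolution_upper:
  fixes f b :: "_ \<Rightarrow> real" and k :: nat
  assumes mono: "\<And>y z. y \<le> z \<Longrightarrow> f y \<le> f z"
    and zero: "\<And>y. y \<le> x0 \<Longrightarrow> f y = 0" and x0: "x0 > 0"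
    and f: "\<And>K'. K' > K \<Longrightarrow> eventually (\<lambda>x. f x \<le> K' * x * ln x ^ k) at_top"
    and b: "\<And>C'. C' > C \<Longrightarrow> eventually (\<lambda>n. b n \<le> C' / real n) sequentially"
    and B: "\<And>n. n \<ge> 1 \<Longrightarrow> b n \<le> B" "B > 0"
    and KC: "K > 0" "C > 0" and D: "D > K * C / real (Suc k)"
  shows "eventually (\<lambda>x. (\<Sum>n | n \<ge> 1 \<and> x0 < x * b n. f (x * b n)) \<le> D * x * ln x ^ Suc k) at_top"
proof -
  \<comment> \<open>As \<open>D\<close> exceeds \<open>K * C / Suc k\<close> strictly, both
    constants can be enlarged by a common \<open>\<delta>\<close> with the quotient still below
    \<open>D\<close>.\<close>
  have "((\<lambda>\<delta>. (K + \<delta>) * (C + \<delta>) / real (Suc k)) \<longlongrightarrow> (K + 0) * (C + 0) / real (Suc k)) (at_right 0)"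
    by (intro tendsto_intros) auto
  then have "eventually (\<lambda>\<delta>. (K + \<delta>) * (C + \<delta>) / real (Suc k) < D \<and> \<delta> > 0) (at_right 0)"
    using D by (intro eventually_conj eventually_at_right_less) (auto dest: order_tendstoD(2))
  then obtain \<delta> where \<delta>: "(K + \<delta>) * (C + \<delta>) / real (Suc k) < D" "\<delta> > 0"
    using eventually_happens trivial_limit_at_right_real by blast
  define K' C' where "K' = K + \<delta>" and "C' = C + \<delta>"
  have K': "K' > K" "K' > 0" and C': "C' > C" "C' > 0" and D': "K' * C' / real (Suc k) < D"
    using \<delta> KC by (auto simp: K'_def C'_def)
  obtain Y where Y: "\<And>x. x \<ge> Y \<Longrightarrow> f x \<le> K' * x * ln x ^ k" "Y \<ge> 1" "Y \<ge> x0"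
  proof -
    obtain Y0 where "\<And>x. x \<ge> Y0 \<Longrightarrow> f x \<le> K' * x * ln x ^ k"
      using f[OF K'(1)] by (auto simp: eventually_at_top_linorder)
    then show ?thesis by (intro that[of "max Y0 (max 1 x0)"]) auto
  qed
  obtain m where m: "\<And>n. n \<ge> m \<Longrightarrow> b n \<le> C' / real n" "m \<ge> 1"
  proof -
    obtain m0 where "\<And>n. n \<ge> m0 \<Longrightarrow> b n \<le> C' / real n"
      using b[OF C'(1)] by (auto simp: eventually_sequentially)
    then show ?thesis by (intro that[of "max m0 1"]) auto
  qed
  have f_nonneg: "f y \<ge> 0" for y
    using mono[of x0 y] zero[of x0] zero[of y] by (cases "y \<le> x0") auto
  \<comment> \<open>The three summands bound the sums over \<open>S1\<close>, \<open>S2\<close> and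
    \<open>S3\<close> below, in this order.\<close>
  define R where "R = (\<lambda>x. real m * (K' * (x * B) * ln (x * B) ^ k)
     + f Y * (C' * x / x0)
     + K' * (C' * x) * (ln (C' * x) ^ k + ln (C' * x) ^ Suc k / real (Suc k)))"
  have bound: "(\<Sum>n | n \<ge> 1 \<and> x0 < x * b n. f (x * b n)) \<le> R x"
    if x: "x > 0" "x * B \<ge> Y" "C' * x \<ge> 1" for x
  proof -
    define Z where "Z = C' * x"
    define S where "S = {n. n \<ge> 1 \<and> x0 < x * b n}"
    define S1 where "S1 = {n \<in> S. n < m}"
    define S2 where "S2 = {n \<in> S. n \<ge> m \<and> x * b n < Y}"
    define S3 where "S3 = {n \<in> S. n \<ge> m \<and> Y \<le> x * b n}"
    have xb: "x * b n \<le> Z / real n" if "n \<ge> m" for n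
      using mult_left_mono[OF m(1)[OF that], of x] x by (simp add: Z_def mult.commute)
    have Z: "Z \<ge> 1" using x by (simp add: Z_def)
    have S2sub: "S2 \<subseteq> {1..nat \<lfloor>Z / x0\<rfloor>}"
    proof
      fix n assume "n \<in> S2"
      then have "n \<ge> 1" "x0 \<le> Z / real n" using xb[of n] by (auto simp: S2_def S_def)
      then have "real n \<le> Z / x0" using x0 by (simp add: field_simps)
      with \<open>n \<ge> 1\<close> show "n \<in> {1..nat \<lfloor>Z / x0\<rfloor>}" by (simp add: le_nat_floor)
    qed
    have S3sub: "S3 \<subseteq> {1..nat \<lfloor>Z\<rfloor>}"
    proof
      fix n assume "n \<in> S3"
      then have "n \<ge> 1" "Y \<le> Z / real n" using xb[of n] by (auto simp: S3_def S_def)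
      moreover from this have "1 \<le> Z / real n" using Y(2) by linarith
      ultimately have "real n \<le> Z" by (simp add: field_simps)
      with \<open>n \<ge> 1\<close> show "n \<in> {1..nat \<lfloor>Z\<rfloor>}" by (simp add: le_nat_floor)
    qed
    have S1sub: "S1 \<subseteq> {..<m}" by (auto simp: S1_def)
    have fin: "finite S1" "finite S2" "finite S3"
      using S1sub S2sub S3sub by (auto intro: finite_subset)
    have "(\<Sum>n\<in>S1. f (x * b n)) \<le> real (card S1) * (K' * (x * B) * ln (x * B) ^ k)"
    proof (rule sum_bounded_above)
      fix n assume "n \<in> S1"
      then have "f (x * b n) \<le> f (x * B)"
        using B x by (intro mono mult_left_mono) (auto simp: S1_def S_def)
      also have "\<dots> \<le> K' * (x * B) * ln (x * B) ^ k" using x by (intro Y(1)) auto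
      finally show "f (x * b n) \<le> K' * (x * B) * ln (x * B) ^ k" .
    qed
    also have "\<dots> \<le> real m * (K' * (x * B) * ln (x * B) ^ k)"
      using card_mono[OF _ S1sub] x Y(2) B(2) K' by (intro mult_right_mono) auto
    finally have 1: "(\<Sum>n\<in>S1. f (x * b n)) \<le> real m * (K' * (x * B) * ln (x * B) ^ k)" .
    have "(\<Sum>n\<in>S2. f (x * b n)) \<le> real (card S2) * f Y"
      by (intro sum_bounded_above mono) (auto simp: S2_def)
    also have "\<dots> \<le> (Z / x0) * f Y"
    proof (intro mult_right_mono f_nonneg)
      have "card S2 \<le> nat \<lfloor>Z / x0\<rfloor>" using card_mono[OF _ S2sub] by simp
      then show "real (card S2) \<le> Z / x0" using Z x0
        by (smt (verit, best) divide_nonneg_pos of_nat_floor of_nat_le_iff)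
    qed
    finally have 2: "(\<Sum>n\<in>S2. f (x * b n)) \<le> f Y * (Z / x0)" by (simp add: mult.commute)
    have "(\<Sum>n\<in>S3. f (x * b n)) \<le> (\<Sum>n\<in>S3. K' * Z * (ln (Z / real n) ^ k / real n))"
    proof (rule sum_mono)
      fix n assume n: "n \<in> S3"
      then have n': "n \<ge> 1" "Y \<le> x * b n" "x * b n \<le> Z / real n" using xb by (auto simp: S3_def S_def)
      have "f (x * b n) \<le> f (Z / real n)" using n' by (intro mono)
      also have "\<dots> \<le> K' * (Z / real n) * ln (Z / real n) ^ k" using n' by (intro Y(1)) auto
      finally show "f (x * b n) \<le> K' * Z * (ln (Z / real n) ^ k / real n)" by simp
    qed
    \<comment> \<open>Passing from \<open>S3\<close> to all \<open>n <= Z\<close> adds only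
      nonnegative summands, since \<open>ln (Z / n) >= 0\<close> there.\<close>
    also have "\<dots> \<le> (\<Sum>n=1..nat \<lfloor>Z\<rfloor>. K' * Z * (ln (Z / real n) ^ k / real n))"
    proof (rule sum_mono2[OF _ S3sub])
      fix n assume "n \<in> {1..nat \<lfloor>Z\<rfloor>} - S3"
      then have "n \<ge> 1" "real n \<le> Z" using Z by (auto simp: le_nat_iff le_floor_iff)
      then show "0 \<le> K' * Z * (ln (Z / real n) ^ k / real n)"
        using K' Z by (intro mult_nonneg_nonneg divide_nonneg_nonneg zero_le_power ln_ge_zero)
          (auto simp: field_simps)
    qed simp
    also have "\<dots> = K' * Z * (\<Sum>n=1..nat \<lfloor>Z\<rfloor>. ln (Z / real n) ^ k / real n)"
      by (simp add: sum_distrib_left)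
    also have "\<dots> \<le> K' * Z * (ln Z ^ k + ln Z ^ Suc k / real (Suc k))"
    proof (intro mult_left_mono)
      have N: "1 \<le> nat \<lfloor>Z\<rfloor>" "real (nat \<lfloor>Z\<rfloor>) \<le> Z" using Z by (auto simp: le_nat_iff)
      have "ln (Z / real (nat \<lfloor>Z\<rfloor>)) \<ge> 0" using N by (intro ln_ge_zero) (auto simp: field_simps)
      then have "ln Z ^ k + (ln Z ^ Suc k - ln (Z / real (nat \<lfloor>Z\<rfloor>)) ^ Suc k) / real (Suc k)
          \<le> ln Z ^ k + ln Z ^ Suc k / real (Suc k)"
        by (intro add_left_mono divide_right_mono) auto
      with sum_ln_power_upper[OF N, of k]
      show "(\<Sum>n=1..nat \<lfloor>Z\<rfloor>. ln (Z / real n) ^ k / real n) \<le> ln Z ^ k + ln Z ^ Suc k / real (Suc k)"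
        by linarith
    qed (use K' Z in auto)
    finally have 3: "(\<Sum>n\<in>S3. f (x * b n)) \<le> K' * Z * (ln Z ^ k + ln Z ^ Suc k / real (Suc k))" .
    have "S = S1 \<union> (S2 \<union> S3)" by (auto simp: S1_def S2_def S3_def)
    moreover have "S1 \<inter> (S2 \<union> S3) = {}" "S2 \<inter> S3 = {}" by (auto simp: S1_def S2_def S3_def)
    ultimately have "(\<Sum>n\<in>S. f (x * b n)) = (\<Sum>n\<in>S1. f (x * b n)) + ((\<Sum>n\<in>S2. f (x * b n)) + (\<Sum>n\<in>S3. f (x * b n)))"
      using fin by (simp add: sum.union_disjoint)
    then show ?thesis using 1 2 3 unfolding S_def[symmetric] R_def Z_def[symmetric] by linarith
  qed
  have "eventually (\<lambda>x. R x / (x * ln x ^ Suc k) < D) at_top"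
  proof (rule order_tendstoD(2)[OF _ D'])
    \<comment> \<open>This is \<open>R x / (x * ln x ^ Suc k)\<close> rewritten in ratios of
      logarithms, which tend to 1, and in \<open>1 / ln x\<close>, which tends to 0. Only the final
      summand survives in the limit.\<close>
    have lim: "((\<lambda>x. real m * (K' * B * (ln (x * B) / ln x) ^ k) * (1 / ln x)
       + f Y * (C' / x0) * (1 / ln x) ^ Suc k
       + K' * C' * ((ln (C' * x) / ln x) ^ k * (1 / ln x) + (ln (C' * x) / ln x) ^ Suc k / real (Suc k)))
       \<longlongrightarrow> real m * (K' * B * 1 ^ k) * 0 + f Y * (C' / x0) * 0 ^ Suc k
         + K' * C' * (1 ^ k * 0 + 1 ^ Suc k / real (Suc k))) at_top"
    proof -
      have 1: "((\<lambda>x. ln (x * B) / ln x) \<longlongrightarrow> 1) at_top" using B(2) by real_asymp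
      have 2: "((\<lambda>x. ln (C' * x) / ln x) \<longlongrightarrow> 1) at_top" using C'(2) by real_asymp
      have 3: "((\<lambda>x::real. 1 / ln x) \<longlongrightarrow> 0) at_top" by real_asymp
      show ?thesis by (intro tendsto_intros 1 2 3) auto
    qed
    show "((\<lambda>x. R x / (x * ln x ^ Suc k)) \<longlongrightarrow> K' * C' / real (Suc k)) at_top"
    proof (rule Lim_transform_eventually)
      show "eventually (\<lambda>x. real m * (K' * B * (ln (x * B) / ln x) ^ k) * (1 / ln x)
       + f Y * (C' / x0) * (1 / ln x) ^ Suc k
       + K' * C' * ((ln (C' * x) / ln x) ^ k * (1 / ln x) + (ln (C' * x) / ln x) ^ Suc k / real (Suc k))
         = R x / (x * ln x ^ Suc k)) at_top"
        using eventually_gt_at_top[of 1]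
      proof eventually_elim
        case (elim x)
        \<comment> \<open>A rational identity with logarithms and powers as atoms: \<open>l\<close>,
          \<open>L\<close>, \<open>L'\<close> stand for \<open>ln x\<close>,
          \<open>ln x ^ k\<close>, \<open>ln x ^ Suc k\<close>, and \<open>r\<close> for
          \<open>Suc k\<close>.\<close>
        have *: "real m * (K' * B * (p / L)) * (1 / l) + F * (C' / x0) * (1 / L')
            + K' * C' * (q / L * (1 / l) + q' / L' / r)
          = (real m * (K' * (x * B) * p) + F * (C' * x / x0) + K' * (C' * x) * (q + q' / r)) / (x * L')"
          if "l \<noteq> 0" "L \<noteq> 0" "r \<noteq> 0" "L' = l * L" for F p q q' l L L' r :: real
          using that(1-3) elim x0 unfolding that(4) by (simp add: field_simps)
        show ?case unfolding R_def power_divide power_one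
          by (rule *) (use elim in auto)
      qed
      show "((\<lambda>x. real m * (K' * B * (ln (x * B) / ln x) ^ k) * (1 / ln x)
       + f Y * (C' / x0) * (1 / ln x) ^ Suc k
       + K' * C' * ((ln (C' * x) / ln x) ^ k * (1 / ln x) + (ln (C' * x) / ln x) ^ Suc k / real (Suc k)))
        \<longlongrightarrow> K' * C' / real (Suc k)) at_top" using lim by simp
    qed
  qed
  moreover have "eventually (\<lambda>x. x * B \<ge> Y) at_top" "eventually (\<lambda>x. C' * x \<ge> 1) at_top"
    using B(2) C'(2) by real_asymp+
  ultimately show ?thesis using eventually_gt_at_top[of 1]
  proof eventually_elim
    case (elim x)
    then have "x > 0" "ln x > 0" by auto
    then have "R x < D * (x * ln x ^ Suc k)" using elim by (simp add: pos_divide_less_eq)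
    moreover have "(\<Sum>n | n \<ge> 1 \<and> x0 < x * b n. f (x * b n)) \<le> R x" using elim by (intro bound) auto
    ultimately show ?case by (simp add: mult.assoc)
  qed
qed

text \<open>All summands are nonnegative, so it suffices to keep \<open>m <= n < N\<close> with
  \<open>N\<close> about \<open>C' * x / Y\<close>. There both asymptotic bounds apply, and
  \<open>sum_ln_power_lower\<close> gives the order \<open>x * ln x ^ Suc k\<close>.\<close>

lemma convolution_lower:
  fixes f b :: "_ \<Rightarrow> real" and k :: nat
  assumes mono: "\<And>y z. y \<le> z \<Longrightarrow> f y \<le> f z"
    and zero: "\<And>y. y \<le> x0 \<Longrightarrow> f y = 0" and x0: "x0 > 0"
    and f: "\<And>K'. K' < K \<Longrightarrow> eventually (\<lambda>x. f x \<ge> K' * x * ln x ^ k) at_top"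
    and b: "\<And>C'. C' < C \<Longrightarrow> eventually (\<lambda>n. b n \<ge> C' / real n) sequentially"
    and b0: "b \<longlonglongrightarrow> 0"
    and KC: "K > 0" "C > 0" and D: "D < K * C / real (Suc k)"
  shows "eventually (\<lambda>x. (\<Sum>n | n \<ge> 1 \<and> x0 < x * b n. f (x * b n)) \<ge> D * x * ln x ^ Suc k) at_top"
proof -
  have "((\<lambda>\<delta>. (K - \<delta>) * (C - \<delta>) / real (Suc k)) \<longlongrightarrow> (K - 0) * (C - 0) / real (Suc k)) (at_right 0)"
    by (intro tendsto_intros) auto
  then have "eventually (\<lambda>\<delta>. D < (K - \<delta>) * (C - \<delta>) / real (Suc k)) (at_right 0)"
    using D by (auto dest: order_tendstoD(1))
  \<comment> \<open>The constants are lowered this time, and \<open>\<delta>\<close> below both of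
    them keeps \<open>K'\<close> and \<open>C'\<close> positive.\<close>
  moreover have "eventually (\<lambda>\<delta>. \<delta> \<in> {0<..<min K C}) (at_right 0)"
    using KC by (intro eventually_at_right_real) auto
  ultimately have "eventually (\<lambda>\<delta>. D < (K - \<delta>) * (C - \<delta>) / real (Suc k) \<and> \<delta> \<in> {0<..<min K C}) (at_right 0)"
    by (rule eventually_conj)
  then obtain \<delta> where \<delta>: "D < (K - \<delta>) * (C - \<delta>) / real (Suc k)" "0 < \<delta>" "\<delta> < K" "\<delta> < C"
    using eventually_happens trivial_limit_at_right_real by fastforce
  define K' C' where "K' = K - \<delta>" and "C' = C - \<delta>"
  have K': "K' < K" "K' > 0" and C': "C' < C" "C' > 0" and D': "D < K' * C' / real (Suc k)"
    using \<delta> by (auto simp: K'_def C'_def)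
  obtain Y where Y: "\<And>x. x \<ge> Y \<Longrightarrow> f x \<ge> K' * x * ln x ^ k" "Y \<ge> 1" "Y > x0"
  proof -
    obtain Y0 where "\<And>x. x \<ge> Y0 \<Longrightarrow> f x \<ge> K' * x * ln x ^ k"
      using f[OF K'(1)] by (auto simp: eventually_at_top_linorder)
    then show ?thesis by (intro that[of "max Y0 (max 1 (x0 + 1))"]) auto
  qed
  obtain m where m: "\<And>n. n \<ge> m \<Longrightarrow> b n \<ge> C' / real n" "m \<ge> 1"
  proof -
    obtain m0 where "\<And>n. n \<ge> m0 \<Longrightarrow> b n \<ge> C' / real n"
      using b[OF C'(1)] by (auto simp: eventually_sequentially)
    then show ?thesis by (intro that[of "max m0 1"]) auto
  qed
  have f_nonneg: "f y \<ge> 0" for y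
    using mono[of x0 y] zero[of x0] zero[of y] by (cases "y \<le> x0") auto
  \<comment> \<open>The term \<open>ln (2 * Y)\<close> bounds \<open>ln (Z / N)\<close>: from
    \<open>Z / Y <= N + 1 <= 2 * N\<close> follows \<open>Z / N <= 2 * Y\<close>. It is independent
    of \<open>x\<close>, hence negligible against \<open>ln x\<close>.\<close>
  define R where "R = (\<lambda>x. K' * (C' * x) * ((ln (C' * x / real m) ^ Suc k - ln (2 * Y) ^ Suc k) / real (Suc k)))"
  have bound: "R x \<le> (\<Sum>n | n \<ge> 1 \<and> x0 < x * b n. f (x * b n))"
    if x: "x > 0" "C' * x / Y \<ge> real m + 1" for x
  proof -
    define Z N where "Z = C' * x" and "N = nat \<lfloor>Z / Y\<rfloor>"
    have ZY: "Z / Y \<ge> real m + 1" using x by (simp add: Z_def)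
    then have N: "m \<le> N" "1 \<le> N" "real N \<le> Z / Y" "Z / Y \<le> real N + 1"
      unfolding N_def using m(2) by (linarith)+
    have Z: "Z > 0" using x C' by (simp add: Z_def)
    have NZ: "real N \<le> Z" using N(3) Y(2) Z
      by (smt (verit) divide_le_eq_1 frac_le div_by_1)
    define S where "S = {n. n \<ge> 1 \<and> x0 < x * b n}"
    \<comment> \<open>A sum over an infinite set is 0 by convention, so finiteness must be secured
      before the partial sum can be compared with the whole.\<close>
    have fin: "finite S"
    proof -
      have "eventually (\<lambda>n. b n < x0 / x) sequentially"
        using order_tendstoD(2)[OF b0, of "x0 / x"] x0 x by simp
      then obtain M where M: "\<And>n. n \<ge> M \<Longrightarrow> b n < x0 / x" by (auto simp: eventually_sequentially)
      have "S \<subseteq> {..<M}"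
      proof
        fix n assume "n \<in> S"
        then have "\<not> b n < x0 / x" using x by (simp add: S_def field_simps)
        then show "n \<in> {..<M}" using M[of n] by force
      qed
      then show ?thesis by (rule finite_subset) simp
    qed
    have xb: "Z / real n \<le> x * b n" if "n \<ge> m" for n
      using mult_left_mono[OF m(1)[OF that], of x] x by (simp add: Z_def mult.commute)
    have YZ: "Y \<le> Z / real n" if "n \<in> {m..<N}" for n
    proof -
      have "n \<ge> 1" "real n \<le> Z / Y" using that m N by auto
      then show ?thesis using Y(2) by (simp add: field_simps)
    qed
    have sub: "{m..<N} \<subseteq> S"
    proof
      fix n assume n: "n \<in> {m..<N}"
      then show "n \<in> S" using xb[of n] YZ[OF n] Y(3) m(2) by (auto simp: S_def)
    qed
    have q: "0 \<le> ln (Z / real N)" "ln (Z / real N) \<le> ln (2 * Y)"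
    proof -
      show "0 \<le> ln (Z / real N)" using NZ N by (intro ln_ge_zero) (auto simp: field_simps)
      have "Z \<le> (real N + 1) * Y" using N(4) Y(2) by (simp add: field_simps)
      also have "\<dots> \<le> (real N + real N) * Y" using N Y by (intro mult_right_mono add_mono) auto
      finally have "Z / real N \<le> 2 * Y" using N by (simp add: field_simps)
      then show "ln (Z / real N) \<le> ln (2 * Y)" using Z N Y(2) by (intro ln_mono) auto
    qed
    have "R x \<le> K' * Z * ((ln (Z / real m) ^ Suc k - ln (Z / real N) ^ Suc k) / real (Suc k))"
      unfolding R_def Z_def[symmetric]
      by (intro mult_left_mono divide_right_mono diff_left_mono power_mono q) (use K' Z in auto)
    also have "\<dots> \<le> K' * Z * (\<Sum>n=m..<N. ln (Z / real n) ^ k / real n)"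
      by (intro mult_left_mono sum_ln_power_lower) (use K' Z m N NZ in auto)
    also have "\<dots> = (\<Sum>n=m..<N. K' * Z * (ln (Z / real n) ^ k / real n))"
      by (simp add: sum_distrib_left)
    also have "\<dots> \<le> (\<Sum>n=m..<N. f (x * b n))"
    proof (rule sum_mono)
      fix n assume n: "n \<in> {m..<N}"
      have "K' * Z * (ln (Z / real n) ^ k / real n) = K' * (Z / real n) * ln (Z / real n) ^ k" by simp
      also have "\<dots> \<le> f (Z / real n)" using YZ[OF n] by (rule Y(1))
      also have "\<dots> \<le> f (x * b n)" using n by (intro mono xb) auto
      finally show "K' * Z * (ln (Z / real n) ^ k / real n) \<le> f (x * b n)" .
    qed
    also have "\<dots> \<le> (\<Sum>n\<in>S. f (x * b n))" by (intro sum_mono2 fin sub f_nonneg)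
    finally show ?thesis unfolding S_def .
  qed
  have "eventually (\<lambda>x. D < R x / (x * ln x ^ Suc k)) at_top"
  proof (rule order_tendstoD(1)[OF _ D'])
    have lim: "((\<lambda>x. K' * C' * (((ln (C' * x / real m) / ln x) ^ Suc k - (ln (2 * Y) * (1 / ln x)) ^ Suc k) / real (Suc k)))
       \<longlongrightarrow> K' * C' * ((1 ^ Suc k - (ln (2 * Y) * 0) ^ Suc k) / real (Suc k))) at_top"
    proof -
      have m0: "real m > 0" using m by simp
      have 1: "((\<lambda>x. ln (C' * x / real m) / ln x) \<longlongrightarrow> 1) at_top" using C'(2) m0 by real_asymp
      have 3: "((\<lambda>x::real. 1 / ln x) \<longlongrightarrow> 0) at_top" by real_asymp
      show ?thesis by (intro tendsto_intros 1 3) auto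
    qed
    show "((\<lambda>x. R x / (x * ln x ^ Suc k)) \<longlongrightarrow> K' * C' / real (Suc k)) at_top"
    proof (rule Lim_transform_eventually)
      show "eventually (\<lambda>x. K' * C' * (((ln (C' * x / real m) / ln x) ^ Suc k - (ln (2 * Y) * (1 / ln x)) ^ Suc k) / real (Suc k))
         = R x / (x * ln x ^ Suc k)) at_top"
        using eventually_gt_at_top[of 1]
      proof eventually_elim
        case (elim x)
        have *: "K' * C' * ((p / l - q * (1 / l)) / r) = K' * (C' * x) * ((p - q) / r) / (x * l)"
          if "l \<noteq> 0" for p q l r :: real
          using that elim by (simp add: diff_divide_distrib[symmetric] ac_simps)
        show ?case unfolding R_def power_divide power_mult_distrib power_one
          by (rule *) (use elim in auto)
      qed
      show "((\<lambda>x. K' * C' * (((ln (C' * x / real m) / ln x) ^ Suc k - (ln (2 * Y) * (1 / ln x)) ^ Suc k) / real (Suc k)))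
         \<longlongrightarrow> K' * C' / real (Suc k)) at_top" using lim by simp
    qed
  qed
  moreover have "eventually (\<lambda>x. C' * x / Y \<ge> real m + 1) at_top"
    using Y(2) C'(2) by real_asymp
  ultimately show ?thesis using eventually_gt_at_top[of 1]
  proof eventually_elim
    case (elim x)
    then have "x > 0" "ln x > 0" by auto
    then have "D * (x * ln x ^ Suc k) < R x" using elim by (simp add: pos_less_divide_eq)
    moreover have "R x \<le> (\<Sum>n | n \<ge> 1 \<and> x0 < x * b n. f (x * b n))" using elim by (intro bound) auto
    ultimately show ?case by (simp add: mult.assoc)
  qed
qed

subsection \<open>Counting tuples\<close>

lemma finite_superlevel_scaled:
  fixes b :: "nat \<Rightarrow> real"
  assumes "b \<longlonglongrightarrow> 0" "x0 > 0"
  shows "finite {n. n \<ge> 1 \<and> x0 < x * b n}"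
proof -
  have "(\<lambda>n. x * b n) \<longlonglongrightarrow> x * 0" by (intro tendsto_intros assms)
  then have "eventually (\<lambda>n. x * b n < x0) sequentially"
    using assms(2) by (auto dest: order_tendstoD(2))
  then obtain M where M: "\<And>n. n \<ge> M \<Longrightarrow> x * b n < x0" by (auto simp: eventually_sequentially)
  have "{n. n \<ge> 1 \<and> x0 < x * b n} \<subseteq> {..<M}"
    using M by (auto simp: not_less[symmetric]) (metis less_asym not_less)
  then show ?thesis by (rule finite_subset) simp
qed

text \<open>The level enters through its reciprocal \<open>x\<close>. The count then grows with
  \<open>x\<close>, and fixing one coordinate \<open>n\<close> just rescales \<open>x\<close> to
  \<open>x * b n\<close>.\<close>

definition superlevel :: "(nat \<Rightarrow> real) \<Rightarrow> nat \<Rightarrow> real \<Rightarrow> (nat \<Rightarrow> nat) set" where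
  "superlevel b d x = {a \<in> tuples d. 1 < x * tensor_power d b a}"

lemma tensor_power_Suc_upd:
  "tensor_power (Suc d) b (g(Suc d := n)) = b n * tensor_power d b g"
proof -
  have "(\<Prod>j=1..d. b ((g(Suc d := n)) j)) = (\<Prod>j=1..d. b (g j))"
    by (intro prod.cong) auto
  then show ?thesis by (simp add: tensor_power_def)
qed

text \<open>The factor \<open>b n\<close> of the last coordinate is absorbed into the scale, since
  \<open>x * (b n * P) = (x * b n) * P\<close>.\<close>

lemma superlevel_Suc:
  "superlevel b (Suc d) x
     = (\<lambda>(n, g). g(Suc d := n)) ` (SIGMA n:{1..}. superlevel b d (x * b n))"
proof -
  have "{1..Suc d} = insert (Suc d) {1..d}" by auto
  then have T: "tuples (Suc d) = (\<lambda>(n, g). g(Suc d := n)) ` ({1..} \<times> tuples d)"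
    unfolding tuples_def by (simp only: PiE_insert_eq)
  show ?thesis
    unfolding superlevel_def T by (auto simp: tensor_power_Suc_upd mult.assoc image_iff)
qed

lemma inj_on_tuples_upd: "inj_on (\<lambda>(n, g). g(Suc d := n)) ({1..} \<times> tuples d)"
  unfolding tuples_def by (rule inj_combinator) auto

context
  fixes b :: "nat \<Rightarrow> real" and B :: real
  assumes b_nonneg: "\<And>n. n \<ge> 1 \<Longrightarrow> 0 \<le> b n" and b_le: "\<And>n. n \<ge> 1 \<Longrightarrow> b n \<le> B"
    and B_pos: "B > 0" and b_lim: "b \<longlonglongrightarrow> 0"
begin

lemma tensor_power_bounds:
  assumes "a \<in> tuples d"
  shows "0 \<le> tensor_power d b a" "tensor_power d b a \<le> B ^ d"
proof -
  have *: "0 \<le> b (a j)" "b (a j) \<le> B" if "j \<in> {1..d}" for j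
    using assms that b_nonneg b_le by (auto simp: tuples_def PiE_iff)
  show "0 \<le> tensor_power d b a"
    unfolding tensor_power_def by (intro prod_nonneg * ballI)
  have "tensor_power d b a \<le> (\<Prod>j=1..d. B)"
    unfolding tensor_power_def by (intro prod_mono conjI *)
  then show "tensor_power d b a \<le> B ^ d" by simp
qed

lemma superlevel_mono: "y \<le> z \<Longrightarrow> superlevel b d y \<subseteq> superlevel b d z"
  unfolding superlevel_def
  using tensor_power_bounds(1) by (auto intro: less_le_trans mult_right_mono)

text \<open>Every product is at most \<open>B ^ d\<close>. This supplies the cutoff
  \<open>x0 = 1 / B ^ d\<close> for the convolution lemmas.\<close>

lemma superlevel_empty:
  assumes "y \<le> 1 / B ^ d"
  shows "superlevel b d y = {}"
proof -
  have "y * tensor_power d b a \<le> 1" if "a \<in> tuples d" for a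
  proof (cases "y \<le> 0")
    case True
    then show ?thesis using tensor_power_bounds(1)[OF that] mult_nonpos_nonneg[of y] by fastforce
  next
    case False
    then have "y * tensor_power d b a \<le> y * B ^ d"
      using tensor_power_bounds(2)[OF that] by (intro mult_left_mono) auto
    also have "\<dots> \<le> 1" using assms B_pos by (simp add: field_simps)
    finally show ?thesis .
  qed
  then show ?thesis by (auto simp: superlevel_def not_less[symmetric])
qed

text \<open>The slices left out are empty. The remaining index set is finite because
  \<open>b\<close> tends to 0, so cardinalities can be summed over it.\<close>

lemma superlevel_Suc_finite_index:
  "superlevel b (Suc d) x = (\<lambda>(n, g). g(Suc d := n)) `
     (SIGMA n:{n. n \<ge> 1 \<and> 1 / B ^ d < x * b n}. superlevel b d (x * b n))"
  unfolding superlevel_Suc using superlevel_empty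
  by (intro arg_cong[where f = "(`) _"]) (auto simp: not_less[symmetric])

lemma finite_superlevel: "finite (superlevel b d x)"
proof (induction d arbitrary: x)
  case 0
  then show ?case by (simp add: superlevel_def tuples_def)
next
  case (Suc d)
  then show ?case unfolding superlevel_Suc_finite_index
    using B_pos by (intro finite_imageI finite_SigmaI finite_superlevel_scaled b_lim) auto
qed

lemma card_superlevel_mono: "y \<le> z \<Longrightarrow> card (superlevel b d y) \<le> card (superlevel b d z)"
  by (intro card_mono finite_superlevel superlevel_mono)

text \<open>This puts the count for \<open>Suc d\<close> in the form of the sums estimated by the
  convolution lemmas, with the count for \<open>d\<close> as \<open>f\<close>.\<close>

lemma card_superlevel_Suc:
  "card (superlevel b (Suc d) x)
     = (\<Sum>n | n \<ge> 1 \<and> 1 / B ^ d < x * b n. card (superlevel b d (x * b n)))"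
proof -
  have "card (superlevel b (Suc d) x)
      = card (SIGMA n:{n. n \<ge> 1 \<and> 1 / B ^ d < x * b n}. superlevel b d (x * b n))"
    unfolding superlevel_Suc_finite_index
    by (intro card_image inj_on_subset[OF inj_on_tuples_upd]) (auto simp: superlevel_def)
  also have "\<dots> = (\<Sum>n | n \<ge> 1 \<and> 1 / B ^ d < x * b n. card (superlevel b d (x * b n)))"
    using B_pos by (intro card_SigmaI finite_superlevel_scaled b_lim finite_superlevel ballI) auto
  finally show ?thesis .
qed

text \<open>There is exactly one 0-tuple, and its empty product is 1; so each slice with
  \<open>1 < x * b n\<close> has one element.\<close>

lemma card_superlevel_1: "card (superlevel b 1 x) = card {n. n \<ge> 1 \<and> 1 < x * b n}"
proof -
  have "card (superlevel b 0 (x * b n)) = 1" if "1 < x * b n" for n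
    using that by (simp add: superlevel_def tuples_def tensor_power_def)
  then show ?thesis using card_superlevel_Suc[of 0 x] by simp
qed

text \<open>Each coordinate added multiplies the constant by \<open>C / Suc k\<close>, which turns
  \<open>C ^ Suc k / fact k\<close> into the next constant of this form. The induction keeps
  \<open>K\<close> arbitrary, as the convolution needs the bound for all constants above the
  limiting one.\<close>

lemma card_superlevel_upper:
  assumes b: "\<And>C'. C' > C \<Longrightarrow> eventually (\<lambda>n. b n \<le> C' / real n) sequentially"
    and C: "C > 0" and K: "K > C ^ Suc k / fact k"
  shows "eventually (\<lambda>x. card (superlevel b (Suc k) x) \<le> K * x * ln x ^ k) at_top"
  using K
proof (induction k arbitrary: K)
  case 0
  \<comment> \<open>The midpoint of \<open>C\<close> and \<open>K\<close> leaves a linear surplus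
    that absorbs the at most \<open>m\<close> indices where the bound on \<open>b\<close> may
    fail.\<close>
  define C' where "C' = (C + K) / 2"
  have C': "C' > C" "C' < K" "C' > 0" using 0 C by (auto simp: C'_def)
  obtain m where m: "\<And>n. n \<ge> m \<Longrightarrow> b n \<le> C' / real n"
    using b[OF C'(1)] by (auto simp: eventually_sequentially)
  have "eventually (\<lambda>x. C' * x + real m \<le> K * x) at_top"
    using C' by real_asymp
  then show ?case using eventually_gt_at_top[of 0]
  proof eventually_elim
    case (elim x)
    have "{n. n \<ge> 1 \<and> 1 < x * b n} \<subseteq> {..<m} \<union> {1..nat \<lfloor>C' * x\<rfloor>}"
    proof
      fix n assume n: "n \<in> {n. n \<ge> 1 \<and> 1 < x * b n}"
      show "n \<in> {..<m} \<union> {1..nat \<lfloor>C' * x\<rfloor>}"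
      proof (cases "n < m")
        case False
        have "1 \<le> x * b n" using n by simp
        also have "\<dots> \<le> x * (C' / real n)" using False elim by (intro mult_left_mono m) auto
        finally have "real n \<le> C' * x" using n by (simp add: field_simps)
        then show ?thesis using n by (simp add: le_nat_floor)
      qed simp
    qed
    then have "card {n. n \<ge> 1 \<and> 1 < x * b n} \<le> card ({..<m} \<union> {1..nat \<lfloor>C' * x\<rfloor>})"
      by (intro card_mono) auto
    also have "\<dots> \<le> m + nat \<lfloor>C' * x\<rfloor>" by (rule order.trans[OF card_Un_le]) simp
    finally have "real (card {n. n \<ge> 1 \<and> 1 < x * b n}) \<le> real m + real (nat \<lfloor>C' * x\<rfloor>)"
      by (simp flip: of_nat_add)
    also have "\<dots> \<le> real m + C' * x" using elim C' by simp
    finally show ?case using elim card_superlevel_1 by simp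
  qed
next
  case (Suc k)
  have "eventually (\<lambda>x. (\<Sum>n | n \<ge> 1 \<and> 1 / B ^ Suc k < x * b n.
      real (card (superlevel b (Suc k) (x * b n)))) \<le> K * x * ln x ^ Suc k) at_top"
  proof (rule convolution_upper[where K = "C ^ Suc k / fact k" and C = C and B = B])
    show "C ^ Suc k / fact k * C / real (Suc k) < K"
      using Suc.prems by (simp add: field_simps)
  qed (use Suc.IH b b_le B_pos C superlevel_empty card_superlevel_mono in auto)
  then show ?case unfolding card_superlevel_Suc[of "Suc k"] of_nat_sum .
qed

lemma card_superlevel_lower:
  assumes b: "\<And>C'. C' < C \<Longrightarrow> eventually (\<lambda>n. b n \<ge> C' / real n) sequentially"
    and C: "C > 0" and K: "K < C ^ Suc k / fact k"
  shows "eventually (\<lambda>x. card (superlevel b (Suc k) x) \<ge> K * x * ln x ^ k) at_top"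
  using K
proof (induction k arbitrary: K)
  case 0
  \<comment> \<open>The \<open>max\<close> keeps \<open>C'\<close> positive even for negative
    \<open>K\<close>.\<close>
  define C' where "C' = (C + max K 0) / 2"
  have C': "C' < C" "C' > K" "C' > 0" using 0 C by (auto simp: C'_def)
  obtain m where m: "\<And>n. n \<ge> m \<Longrightarrow> b n \<ge> C' / real n"
    using b[OF C'(1)] by (auto simp: eventually_sequentially)
  \<comment> \<open>The loss \<open>m + 2\<close> consists of \<open>m + 1\<close> for the indices
    below \<open>Suc m\<close> and 1 for rounding \<open>C' * x\<close> down.\<close>
  have "eventually (\<lambda>x. C' * x - (real m + 2) \<ge> K * x) at_top"
    using C' by real_asymp
  then show ?case using eventually_gt_at_top[of 0]
  proof eventually_elim
    case (elim x)
    define N where "N = nat \<lfloor>C' * x\<rfloor>"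
    have N: "real N \<le> C' * x" "C' * x \<le> real N + 1"
      using elim C' unfolding N_def by simp_all
    have sub: "{Suc m..<N} \<subseteq> {n. n \<ge> 1 \<and> 1 < x * b n}"
    proof
      fix n assume n: "n \<in> {Suc m..<N}"
      then have "real n < C' * x" using N by auto
      then have "1 < x * (C' / real n)" using n by (simp add: field_simps)
      also have "\<dots> \<le> x * b n" using n elim by (intro mult_left_mono m) auto
      finally show "n \<in> {n. n \<ge> 1 \<and> 1 < x * b n}" using n by simp
    qed
    have "card {Suc m..<N} \<le> card {n. n \<ge> 1 \<and> 1 < x * b n}"
      by (intro card_mono sub finite_superlevel_scaled b_lim) auto
    then have "real N - (real m + 1) \<le> real (card {n. n \<ge> 1 \<and> 1 < x * b n})" by simp
    then show ?case using elim N card_superlevel_1 by simp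
  qed
next
  case (Suc k)
  have "eventually (\<lambda>x. (\<Sum>n | n \<ge> 1 \<and> 1 / B ^ Suc k < x * b n.
      real (card (superlevel b (Suc k) (x * b n)))) \<ge> K * x * ln x ^ Suc k) at_top"
  proof (rule convolution_lower[where K = "C ^ Suc k / fact k" and C = C])
    show "K < C ^ Suc k / fact k * C / real (Suc k)"
      using Suc.prems by (simp add: field_simps)
  qed (use Suc.IH b b_lim B_pos C superlevel_empty card_superlevel_mono in auto)
  then show ?case unfolding card_superlevel_Suc[of "Suc k"] of_nat_sum .
qed

end

subsection \<open>From counting to the rearrangement\<close>

lemma asymp_leI:
  fixes f g :: "nat \<Rightarrow> real"
  assumes "eventually (\<lambda>n. g n > 0) sequentially"
    and "\<And>e. e > 1 \<Longrightarrow> eventually (\<lambda>n. f n \<le> e * g n) sequentially"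
  shows "f \<lesssim> g"
  unfolding asymp_le_def Limsup_le_iff
proof (intro allI impI)
  fix y :: ereal assume "y > 1"
  then obtain e where e: "1 < ereal e" "ereal e < y" using ereal_dense2 by blast
  then have "e > 1" by simp
  from assms(2)[OF this] assms(1) show "eventually (\<lambda>n. ereal (f n / g n) < y) sequentially"
  proof eventually_elim
    case (elim n)
    then have "ereal (f n / g n) \<le> ereal e" by (simp add: field_simps)
    then show ?case using e(2) by (rule le_less_trans)
  qed
qed

lemma asymp_geI:
  fixes f g :: "nat \<Rightarrow> real"
  assumes "eventually (\<lambda>n. g n > 0) sequentially"
    and "\<And>e. 0 < e \<Longrightarrow> e < 1 \<Longrightarrow> eventually (\<lambda>n. f n \<ge> e * g n) sequentially"
  shows "f \<greatersim> g"
  unfolding asymp_ge_def le_Liminf_iff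
proof (intro allI impI)
  fix y :: ereal assume "y < 1"
  \<comment> \<open>Replacing \<open>y\<close> by \<open>max y 0\<close> yields a positive
    \<open>e\<close> also when \<open>y\<close> is negative or minus infinity.\<close>
  then have "max y 0 < 1" by simp
  then obtain e where e: "max y 0 < ereal e" "ereal e < 1" using ereal_dense2 by blast
  then have "0 < e" "e < 1" by simp_all
  from assms(2)[OF this] assms(1) show "eventually (\<lambda>n. y < ereal (f n / g n)) sequentially"
  proof eventually_elim
    case (elim n)
    then have "ereal e \<le> ereal (f n / g n)" by (simp add: field_simps)
    moreover have "y < ereal e" using e(1) by simp
    ultimately show ?case by (rule less_le_trans[rotated])
  qed
qed

lemma asymp_leD:
  fixes f g :: "nat \<Rightarrow> real"
  assumes "f \<lesssim> g" "eventually (\<lambda>n. g n > 0) sequentially" "e > 1"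
  shows "eventually (\<lambda>n. f n \<le> e * g n) sequentially"
proof -
  have "eventually (\<lambda>n. ereal (f n / g n) < ereal e) sequentially"
    using assms(1)[unfolded asymp_le_def Limsup_le_iff, rule_format, of "ereal e"] assms(3) by simp
  then show ?thesis using assms(2)
    by eventually_elim (simp add: pos_divide_less_eq less_imp_le)
qed

lemma asymp_geD:
  fixes f g :: "nat \<Rightarrow> real"
  assumes "f \<greatersim> g" "eventually (\<lambda>n. g n > 0) sequentially" "e < 1"
  shows "eventually (\<lambda>n. f n \<ge> e * g n) sequentially"
proof -
  have "eventually (\<lambda>n. ereal e < ereal (f n / g n)) sequentially"
    using assms(1)[unfolded asymp_ge_def le_Liminf_iff, rule_format, of "ereal e"] assms(3) by simp
  then show ?thesis using assms(2)
    by eventually_elim (simp add: pos_less_divide_eq less_imp_le)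
qed

text \<open>Otherwise the entries that are at least \<open>v\<close> lie among the fewer than
  \<open>n\<close> entries above \<open>t\<close>. Finiteness rules out the infinite alternative in
  \<open>nth_largest\<close>.\<close>

lemma nth_largest_le:
  assumes v: "nth_largest A f n v" and t: "finite {a \<in> A. f a > t}" "card {a \<in> A. f a > t} < n"
  shows "v \<le> t"
proof (rule ccontr)
  assume "\<not> v \<le> t"
  then have sub: "{a \<in> A. f a \<ge> v} \<subseteq> {a \<in> A. f a > t}" by auto
  then have "finite {a \<in> A. f a \<ge> v}" using t(1) by (rule finite_subset)
  then have "n \<le> card {a \<in> A. f a \<ge> v}" using v by (simp add: nth_largest_def)
  also have "\<dots> \<le> card {a \<in> A. f a > t}" by (rule card_mono[OF t(1) sub])
  finally show False using t(2) by simp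
qed

text \<open>Otherwise the entries above \<open>t\<close> lie among those above \<open>v\<close>,
  which are fewer than \<open>n\<close>.\<close>

lemma nth_largest_gt:
  assumes v: "nth_largest A f n v" and t: "n \<le> card {a \<in> A. f a > t}"
  shows "t < v"
proof (rule ccontr)
  assume "\<not> t < v"
  then have "{a \<in> A. f a > t} \<subseteq> {a \<in> A. f a > v}" by auto
  then have "card {a \<in> A. f a > t} \<le> card {a \<in> A. f a > v}"
    using v by (intro card_mono) (auto simp: nth_largest_def)
  then show False using v t by (simp add: nth_largest_def)
qed

text \<open>Taking \<open>1 / s\<close>-th powers commutes with products and preserves strict order
  on nonnegative reals, so level \<open>x powr - s\<close> becomes level
  \<open>1 / x\<close>.\<close>

lemma tensor_power_gt_iff_superlevel:
  assumes nonneg: "\<And>n. n \<ge> 1 \<Longrightarrow> \<sigma> n \<ge> 0" and "x > 0" "s > 0"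
  shows "{a \<in> tuples d. tensor_power d \<sigma> a > x powr - s} = superlevel (\<lambda>n. \<sigma> n powr (1 / s)) d x"
proof -
  have "x powr - s < tensor_power d \<sigma> a \<longleftrightarrow> 1 < x * tensor_power d (\<lambda>n. \<sigma> n powr (1 / s)) a"
    if a: "a \<in> tuples d" for a
  proof -
    define P where "P = tensor_power d \<sigma> a"
    define u where "u = P powr (1 / s)"
    have "P \<ge> 0" unfolding P_def tensor_power_def
      using a nonneg by (intro prod_nonneg) (auto simp: tuples_def PiE_iff)
    then have P: "P = u powr s" and u: "u \<ge> 0" using \<open>s > 0\<close> by (auto simp: u_def powr_powr)
    have T: "tensor_power d (\<lambda>n. \<sigma> n powr (1 / s)) a = u"
      unfolding u_def P_def tensor_power_def by (rule prod_powr_distrib[symmetric])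
    have "x powr - s = (1 / x) powr s" using \<open>x > 0\<close> by (simp add: powr_minus_divide powr_divide)
    then have "x powr - s < P \<longleftrightarrow> (1 / x) powr s < u powr s" by (simp add: P)
    also have "\<dots> \<longleftrightarrow> 1 / x < u"
      using powr_less_mono2[of s "1 / x" u] powr_mono2[of s u "1 / x"] u assms(2,3)
      by (meson divide_nonneg_nonneg less_imp_le not_less zero_le_one)
    also have "\<dots> \<longleftrightarrow> 1 < x * u" using \<open>x > 0\<close> by (simp add: field_simps)
    finally show ?thesis by (simp add: T flip: P_def)
  qed
  then show ?thesis by (auto simp: superlevel_def)
qed

text \<open>The substitution below solves \<open>K * x * (ln x) ^ k = n\<close> for \<open>x\<close> up to a factor tending to 1.\<close>

context
  fixes K :: real and k :: nat and X :: "nat \<Rightarrow> real"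
  assumes K_pos: "K > 0"
  defines "X \<equiv> \<lambda>n. real n / (K * ln (real n) ^ k)"
begin

text \<open>Here \<open>ln (X n) = ln n - ln K - k * ln (ln n)\<close>, and the last two terms are
  negligible against \<open>ln n\<close>.\<close>

lemma ln_inverse_scale: "(\<lambda>n. ln (X n) / ln (real n)) \<longlonglongrightarrow> 1"
proof (rule Lim_transform_eventually)
  have 1: "(\<lambda>n. 1 / ln (real n)) \<longlonglongrightarrow> 0" by real_asymp
  have 2: "(\<lambda>n. ln (ln (real n)) / ln (real n)) \<longlonglongrightarrow> 0" by real_asymp
  have "(\<lambda>n. 1 - ln K * (1 / ln (real n)) - real k * (ln (ln (real n)) / ln (real n)))
     \<longlonglongrightarrow> 1 - ln K * 0 - real k * 0" by (intro tendsto_intros 1 2)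
  then show "(\<lambda>n. 1 - ln K * (1 / ln (real n)) - real k * (ln (ln (real n)) / ln (real n))) \<longlonglongrightarrow> 1"
    by simp
  show "eventually (\<lambda>n. 1 - ln K * (1 / ln (real n)) - real k * (ln (ln (real n)) / ln (real n))
      = ln (X n) / ln (real n)) sequentially"
    using eventually_gt_at_top[of 1]
  proof eventually_elim
    case (elim n)
    then have "real n > 0" "ln (real n) > 0" by simp_all
    then show ?case using K_pos unfolding X_def
      by (simp add: ln_div ln_mult ln_realpow field_simps)
  qed
qed

lemma filterlim_inverse_scale: "filterlim X at_top sequentially"
proof -
  have "filterlim (\<lambda>n. exp (ln (X n) / ln (real n) * ln (real n))) at_top sequentially"
    by (intro filterlim_compose[OF exp_at_top] filterlim_tendsto_pos_mult_at_top[OF ln_inverse_scale])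
      (simp, real_asymp)
  moreover have "eventually (\<lambda>n. exp (ln (X n) / ln (real n) * ln (real n)) = X n) sequentially"
    using eventually_gt_at_top[of 1]
  proof eventually_elim
    case (elim n)
    then have "ln (real n) > 0" by simp
    then have "X n > 0" using K_pos elim by (simp add: X_def)
    then show ?case using \<open>ln (real n) > 0\<close> by simp
  qed
  ultimately show ?thesis using filterlim_cong[OF refl refl] by fast
qed

text \<open>The quotient equals \<open>K' / K * (ln (X n) / ln n) ^ k\<close>. Thus a count
  asymptotically bounded with constant \<open>K'\<close> is compared with \<open>n\<close> by
  comparing \<open>K'\<close> with \<open>K\<close>.\<close>

lemma inverse_scale_asymp: "(\<lambda>n. K' * X n * ln (X n) ^ k / real n) \<longlonglongrightarrow> K' / K"
proof (rule Lim_transform_eventually)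
  have "(\<lambda>n. K' / K * (ln (X n) / ln (real n)) ^ k) \<longlonglongrightarrow> K' / K * 1 ^ k"
    by (intro tendsto_intros ln_inverse_scale)
  then show "(\<lambda>n. K' / K * (ln (X n) / ln (real n)) ^ k) \<longlonglongrightarrow> K' / K" by simp
  show "eventually (\<lambda>n. K' / K * (ln (X n) / ln (real n)) ^ k = K' * X n * ln (X n) ^ k / real n) sequentially"
    using eventually_gt_at_top[of 1]
  proof eventually_elim
    case (elim n)
    have "K' / K * (l / m) = K' * (real n / (K * m)) * l / real n" for l m
      using elim by simp
    then show ?case unfolding power_divide by (simp add: X_def)
  qed
qed

end

lemma inverse_scale_powr:
  assumes "K > 0" "n > 1"
  shows "(real n / (K * ln (real n) ^ k)) powr - s
     = K powr s * (real n powr - s * ln (real n) powr (s * real k))"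
proof -
  have l: "ln (real n) > 0" using assms(2) by simp
  have "(ln (real n) ^ k) powr s = ln (real n) powr (s * real k)"
    using l by (simp add: powr_powr mult.commute flip: powr_realpow)
  then show ?thesis using assms l
    by (simp add: powr_divide powr_mult powr_minus field_simps)
qed

section \<open>Choice of constants and inversion of the counting estimates\<close>

theorem theorem2:
  fixes d :: nat and \<sigma> \<tau> :: "nat \<Rightarrow> real" and c s :: real
  assumes "d \<ge> 1"
    and "nonincreasing_zero_seq \<sigma>"
    and "nonincreasing_rearrangement (tuples d) (tensor_power d \<sigma>) \<tau>"
    and "c > 0" and "s > 0"
  shows "((\<lambda>n. \<sigma> n) \<lesssim> (\<lambda>n. c * real n powr (- s)) \<longrightarrow>
            (\<lambda>n. \<tau> n) \<lesssim>
            (\<lambda>n. c ^ d / (fact (d - 1)) powr s * real n powr (- s)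
                  * ln (real n) powr (s * (real d - 1))))
       \<and> ((\<lambda>n. \<sigma> n) \<greatersim> (\<lambda>n. c * real n powr (- s)) \<longrightarrow>
            (\<lambda>n. \<tau> n) \<greatersim>
            (\<lambda>n. c ^ d / (fact (d - 1)) powr s * real n powr (- s)
                  * ln (real n) powr (s * (real d - 1))))"
proof -
  obtain k where d: "d = Suc k" using \<open>d \<ge> 1\<close> by (cases d) auto
  have mono: "\<sigma> n \<le> \<sigma> m" if "1 \<le> m" "m \<le> n" for m n
    using assms(2) that by (auto simp: nonincreasing_zero_seq_def monotone_on_def)
  have lim: "\<sigma> \<longlonglongrightarrow> 0" using assms(2) by (simp add: nonincreasing_zero_seq_def)
  have nonneg: "\<sigma> n \<ge> 0" if "n \<ge> 1" for n
    using lim by (rule LIMSEQ_le_const2) (use mono that in blast)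
  have \<tau>: "nth_largest (tuples d) (tensor_power d \<sigma>) n (\<tau> n)" if "n \<ge> 1" for n
    using assms(3) that by (simp add: nonincreasing_rearrangement_def)
  define b where "b = (\<lambda>n. \<sigma> n powr (1 / s))"
  \<comment> \<open>The value \<open>b 1\<close> is the largest; adding 1 makes \<open>B\<close>
    positive even if \<open>\<sigma>\<close> vanishes identically.\<close>
  define B where "B = b 1 + 1"
  define C where "C = c powr (1 / s)"
  \<comment> \<open>This is the constant of the counting function; \<open>L powr s\<close> is the
    constant of the theorem.\<close>
  define L where "L = C ^ d / fact k"
  define G where "G = (\<lambda>n. c ^ d / (fact (d - 1)) powr s * real n powr (- s)
                  * ln (real n) powr (s * (real d - 1)))"
  define X where "X = (\<lambda>K n. real n / (K * ln (real n) ^ k))"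
  have C: "C > 0" and L: "L > 0" using \<open>c > 0\<close> by (auto simp: C_def L_def)
  have b: "0 \<le> b n" "b n \<le> B" if "n \<ge> 1" for n
    using that mono[of 1 n] nonneg[of n] \<open>s > 0\<close> powr_mono2[of "1 / s" "\<sigma> n" "\<sigma> 1"]
    by (auto simp: b_def B_def)
  have B: "B > 0" using b(1)[of 1] by (simp add: B_def)
  have b_lim: "b \<longlonglongrightarrow> 0"
  proof -
    have "eventually (\<lambda>n. 0 \<le> \<sigma> n) sequentially"
      using eventually_ge_at_top[of 1] by eventually_elim (rule nonneg)
    then have "b \<longlonglongrightarrow> 0 powr (1 / s)"
      unfolding b_def using \<open>s > 0\<close> by (intro tendsto_powr' lim tendsto_const) auto
    then show ?thesis by simp
  qed
  have level: "{a \<in> tuples d. tensor_power d \<sigma> a > x powr - s} = superlevel b d x" if "x > 0" for x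
    unfolding b_def by (rule tensor_power_gt_iff_superlevel[OF nonneg that \<open>s > 0\<close>])
  have fin: "finite (superlevel b d x)" for x
    using b B b_lim by (rule finite_superlevel)
  have c: "c = C powr s" using \<open>c > 0\<close> \<open>s > 0\<close> by (simp add: C_def powr_powr)
  \<comment> \<open>A change of constant from \<open>C\<close> to \<open>C'\<close> for
    \<open>b\<close> amounts to a factor \<open>(C' / C) powr s\<close> for \<open>\<sigma>\<close>,
    which serves as the \<open>e\<close> of the epsilon form.\<close>
  have C_scale: "C' / real n = ((C' / C) powr s * (c * real n powr (- s))) powr (1 / s)"
    if "C' > 0" "n \<ge> 1" for C' n
  proof -
    have "(C' / C) powr s * (c * real n powr (- s)) = (C' / real n) powr s"
      using that C by (simp add: c powr_divide powr_minus_divide)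
    then show ?thesis using that \<open>s > 0\<close> by (simp add: powr_powr)
  qed
  have Xs: "X K n powr - s = (K / L) powr s * G n" if "K > 0" "n > 1" for K n
  proof -
    have "c ^ d = (C ^ d) powr s"
      using C by (simp add: c powr_powr mult.commute flip: powr_realpow)
    then have "c ^ d / fact (d - 1) powr s = L powr s"
      using C by (simp add: L_def powr_divide d)
    then have "G n = L powr s * (real n powr - s * ln (real n) powr (s * real k))"
      by (simp add: G_def d)
    then show ?thesis using inverse_scale_powr[OF that, of k s] L that
      by (simp add: X_def powr_divide)
  qed
  have G_pos: "eventually (\<lambda>n. G n > 0) sequentially"
    using eventually_gt_at_top[of 1]
    by eventually_elim (use \<open>c > 0\<close> in \<open>simp add: G_def\<close>)
  have g_pos: "eventually (\<lambda>n. c * real n powr (- s) > 0) sequentially"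
    using eventually_gt_at_top[of 0] by eventually_elim (use \<open>c > 0\<close> in simp)
  have "\<tau> \<lesssim> G" if \<sigma>: "\<sigma> \<lesssim> (\<lambda>n. c * real n powr (- s))"
  proof (rule asymp_leI[OF G_pos])
    fix e :: real assume e: "e > 1"
    \<comment> \<open>Chosen so that \<open>(K / L) powr s = e\<close>, whence
      \<open>X K n powr - s = e * G n\<close>. With \<open>L < K' < K\<close> the bound on the count
      divided by \<open>n\<close> tends to \<open>K' / K < 1\<close>, so eventually fewer than
      \<open>n\<close> products exceed this level.\<close>
    define K where "K = L * e powr (1 / s)"
    have "e powr (1 / s) > 1" using e \<open>s > 0\<close> by (intro gr_one_powr) auto
    then have K: "K > L" using L by (simp add: K_def)
    then obtain K' where K': "L < K'" "K' < K" using dense by blast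
    have "eventually (\<lambda>n. b n \<le> C' / real n) sequentially" if C': "C' > C" for C'
    proof -
      have "(C' / C) powr s > 1" using C C' \<open>s > 0\<close> by (intro gr_one_powr) auto
      from asymp_leD[OF \<sigma> g_pos this] eventually_ge_at_top[of 1] show ?thesis
      proof eventually_elim
        case (elim n)
        then show ?case using C_scale[of C' n] C C' nonneg[of n] \<open>s > 0\<close>
          by (simp add: b_def powr_mono2)
      qed
    qed
    then have "eventually (\<lambda>x. real (card (superlevel b d x)) \<le> K' * x * ln x ^ k) at_top"
      unfolding d using K' by (intro card_superlevel_upper[OF b B b_lim]) (auto simp: C L_def d)
    then have "eventually (\<lambda>n. real (card (superlevel b d (X K n))) \<le> K' * X K n * ln (X K n) ^ k) sequentially"
      using K L unfolding X_def by (intro eventually_compose_filterlim[OF _ filterlim_inverse_scale]) auto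
    moreover have "eventually (\<lambda>n. K' * X K n * ln (X K n) ^ k / real n < 1) sequentially"
      unfolding X_def using K L K' by (intro order_tendstoD(2)[OF inverse_scale_asymp]) auto
    ultimately show "eventually (\<lambda>n. \<tau> n \<le> e * G n) sequentially"
      using eventually_gt_at_top[of 1]
    proof eventually_elim
      case (elim n)
      have Xpos: "X K n > 0" using K L elim by (simp add: X_def)
      have "card (superlevel b d (X K n)) < n" using elim by (simp add: pos_divide_less_eq)
      then have "\<tau> n \<le> X K n powr - s"
        using elim by (intro nth_largest_le[OF \<tau>]) (simp_all add: level[OF Xpos] fin)
      also have "\<dots> = e * G n"
        using K L e elim \<open>s > 0\<close> by (simp add: Xs K_def powr_powr)
      finally show ?case .
    qed
  qed
  moreover have "\<tau> \<greatersim> G" if \<sigma>: "\<sigma> \<greatersim> (\<lambda>n. c * real n powr (- s))"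
  proof (rule asymp_geI[OF G_pos])
    fix e :: real assume e: "0 < e" "e < 1"
    \<comment> \<open>The same choice with \<open>e < 1\<close> gives \<open>K < L\<close>. For
      \<open>K < K' < L\<close> the limit \<open>K' / K\<close> exceeds 1, so eventually at least
      \<open>n\<close> products exceed the level \<open>e * G n\<close>.\<close>
    define K where "K = L * e powr (1 / s)"
    have "e powr (1 / s) < 1 powr (1 / s)" using e \<open>s > 0\<close> by (intro powr_less_mono2) auto
    then have K: "K < L" "K > 0" using L e by (auto simp: K_def)
    then obtain K' where K': "K < K'" "K' < L" using dense by blast
    have "eventually (\<lambda>n. b n \<ge> C' / real n) sequentially" if C': "C' < C" for C'
    proof (cases "C' > 0")
      case True
      have "(C' / C) powr s < 1 powr s" using C C' True \<open>s > 0\<close> by (intro powr_less_mono2) auto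
      then have "(C' / C) powr s < 1" by simp
      from asymp_geD[OF \<sigma> g_pos this] eventually_ge_at_top[of 1] show ?thesis
      proof eventually_elim
        case (elim n)
        then show ?case using C_scale[OF True, of n] True \<open>c > 0\<close> \<open>s > 0\<close>
          by (simp add: b_def powr_mono2)
      qed
    next
      \<comment> \<open>For \<open>C' <= 0\<close> the bound is trivial because \<open>b\<close> is
        nonnegative; the rescaling by \<open>(C' / C) powr s\<close> is meaningful only for positive
        \<open>C'\<close>.\<close>
      case False
      then have "C' / real n \<le> 0" for n by (simp add: divide_nonpos_nonneg)
      then show ?thesis using b(1)
        by (intro eventually_mono[OF eventually_ge_at_top[of 1]]) (meson order.trans)
    qed
    then have "eventually (\<lambda>x. real (card (superlevel b d x)) \<ge> K' * x * ln x ^ k) at_top"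
      unfolding d using K' by (intro card_superlevel_lower[OF b B b_lim]) (auto simp: C L_def d)
    then have "eventually (\<lambda>n. real (card (superlevel b d (X K n))) \<ge> K' * X K n * ln (X K n) ^ k) sequentially"
      using K L unfolding X_def by (intro eventually_compose_filterlim[OF _ filterlim_inverse_scale]) auto
    moreover have "eventually (\<lambda>n. 1 < K' * X K n * ln (X K n) ^ k / real n) sequentially"
      unfolding X_def using K L K' by (intro order_tendstoD(1)[OF inverse_scale_asymp]) auto
    ultimately show "eventually (\<lambda>n. \<tau> n \<ge> e * G n) sequentially"
      using eventually_gt_at_top[of 1]
    proof eventually_elim
      case (elim n)
      have Xpos: "X K n > 0" using K elim by (simp add: X_def)
      have "n \<le> card (superlevel b d (X K n))" using elim by (simp add: pos_less_divide_eq)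
      then have "X K n powr - s < \<tau> n"
        using elim by (intro nth_largest_gt[OF \<tau>]) (simp_all add: level[OF Xpos])
      moreover have "X K n powr - s = e * G n"
        using K L e elim \<open>s > 0\<close> by (simp add: Xs K_def powr_powr)
      ultimately show ?case by simp
    qed
  qed
  ultimately show ?thesis unfolding G_def by simp
qed

end
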